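(* Let $X$ be a real Banach space, let $(G,\tau)$ be a compact topological group of $\mathcal{L}(X)$ that acts separately continuously on $X$, and let $K$ be a set in $X$ that is invariant under the action of $G$. If $z$ is an element of $X\setminus K$ that can be separated from $K$ by a continuous polynomial $Q$, then there exists a $G$-invariant continuous polynomial $P$ that separates $z$ and $K$. Furthermore, if $Q$ is homogeneous, then $P$ can be chosen to be homogeneous.
   Context: $\mathcal{L}(X)$ is the space of continuous linear maps from $X$ into itself. A topological group of $\mathcal{L}(X)$ is a set $G\subset\mathcal{L}(X)$ that is a group under composition (with identity $Id_X$), endowed with a topology $\tau$, possibly different from the natural topology of $\mathcal{L}(X)$, making it a topological group; it acts on $X$ by $(\gamma,x)\mapsto\gamma(x)$, and the action is separately continuous if the map $G\times X\to X$, $(\gamma,x)\mapsto\gamma(x)$, is separately continuous. Compact groups are Hausdorff. A set $K\subset X$ is invariant under the action of $G$ if $\gamma(K)\subset K$ for every $\gamma\in G$. Polynomials on $X$ are scalar-valued. A polynomial $P$ on $X$ is $G$-invariant if $P(\gamma(x))=P(x)$ for all $x\in X$, $\gamma\in G$. A polynomial $P$ separates a point $z$ and a set $K$ (equivalently, $z$ is separated from $K$ by $P$) if $\sup_{w\in K}|P(w)|<|P(z)|$. *)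

theory Defs
  imports "HOL-Analysis.Analysis" "HOL-Algebra.Group"
begin

definition operator_monoid ::
    "('a::real_normed_vector \<Rightarrow>\<^sub>L 'a) set \<Rightarrow> ('a \<Rightarrow>\<^sub>L 'a) monoid"
  where "operator_monoid G = \<lparr>carrier = G, monoid.mult = (o\<^sub>L), one = id_blinfun\<rparr>"

text \<open>The topology \<open>\<tau>\<close> is arbitrary: it need not be related to the operator norm topology that
  \<^typ>\<open>'a \<Rightarrow>\<^sub>L 'a\<close> carries as a type.\<close>

definition topological_operator_group ::
    "('a::real_normed_vector \<Rightarrow>\<^sub>L 'a) set \<Rightarrow> ('a \<Rightarrow>\<^sub>L 'a) topology \<Rightarrow> bool"
  where "topological_operator_group G \<tau> \<longleftrightarrow>
    group (operator_monoid G) \<and> topspace \<tau> = G \<and>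
    continuous_map (prod_topology \<tau> \<tau>) \<tau> (\<lambda>(\<gamma>, \<delta>). \<gamma> o\<^sub>L \<delta>) \<and>
    continuous_map \<tau> \<tau> (\<lambda>\<gamma>. inv\<^bsub>operator_monoid G\<^esub> \<gamma>)"

definition compact_operator_group ::
    "('a::real_normed_vector \<Rightarrow>\<^sub>L 'a) set \<Rightarrow> ('a \<Rightarrow>\<^sub>L 'a) topology \<Rightarrow> bool"
  where "compact_operator_group G \<tau> \<longleftrightarrow>
    topological_operator_group G \<tau> \<and> compact_space \<tau> \<and> Hausdorff_space \<tau>"

definition acts_separately_continuously ::
    "('a::real_normed_vector \<Rightarrow>\<^sub>L 'a) set \<Rightarrow> ('a \<Rightarrow>\<^sub>L 'a) topology \<Rightarrow> bool"
  where "acts_separately_continuously G \<tau> \<longleftrightarrow>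
    (\<forall>x. continuous_map \<tau> euclidean (\<lambda>\<gamma>. blinfun_apply \<gamma> x)) \<and>
    (\<forall>\<gamma>\<in>G. continuous_on UNIV (blinfun_apply \<gamma>))"

definition invariant_set ::
    "('a::real_normed_vector \<Rightarrow>\<^sub>L 'a) set \<Rightarrow> 'a set \<Rightarrow> bool"
  where "invariant_set G K \<longleftrightarrow> (\<forall>\<gamma>\<in>G. blinfun_apply \<gamma> ` K \<subseteq> K)"

text \<open>An \<open>n\<close>-tuple is encoded as a function on \<^typ>\<open>nat\<close> of which only the values at indices below
  \<open>n\<close> matter; the first conjunct makes the form independent of the remaining ones. For \<open>n = 0\<close> these
  are exactly the constants.\<close>

definition multilinear_form :: "nat \<Rightarrow> ((nat \<Rightarrow> 'a::real_vector) \<Rightarrow> real) \<Rightarrow> bool"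
  where "multilinear_form n A \<longleftrightarrow>
    (\<forall>v w. (\<forall>i<n. v i = w i) \<longrightarrow> A v = A w) \<and>
    (\<forall>i<n. \<forall>v. linear (\<lambda>x. A (v(i := x))))"

definition homogeneous_polynomial :: "nat \<Rightarrow> ('a::real_vector \<Rightarrow> real) \<Rightarrow> bool"
  where "homogeneous_polynomial n P \<longleftrightarrow>
    (\<exists>A. multilinear_form n A \<and> (\<forall>x. P x = A (\<lambda>_. x)))"

definition polynomial_on_space :: "('a::real_vector \<Rightarrow> real) \<Rightarrow> bool"
  where "polynomial_on_space P \<longleftrightarrow>
    (\<exists>m p. (\<forall>n\<le>m. homogeneous_polynomial n (p n)) \<and> (\<forall>x. P x = (\<Sum>n\<le>m. p n x)))"

definition continuous_polynomial :: "('a::real_normed_vector \<Rightarrow> real) \<Rightarrow> bool"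
  where "continuous_polynomial P \<longleftrightarrow> polynomial_on_space P \<and> continuous_on UNIV P"

definition is_homogeneous :: "('a::real_vector \<Rightarrow> real) \<Rightarrow> bool"
  where "is_homogeneous P \<longleftrightarrow> (\<exists>n. homogeneous_polynomial n P)"

definition invariant_function ::
    "('a::real_normed_vector \<Rightarrow>\<^sub>L 'a) set \<Rightarrow> ('a \<Rightarrow> real) \<Rightarrow> bool"
  where "invariant_function G P \<longleftrightarrow> (\<forall>\<gamma>\<in>G. \<forall>x. P (blinfun_apply \<gamma> x) = P x)"

text \<open>The supremum is taken in the extended reals, so that an unbounded \<open>P\<close> on \<open>K\<close> has supremum
  \<open>\<infinity>\<close> and does not separate.\<close>

definition separates :: "('a \<Rightarrow> real) \<Rightarrow> 'a \<Rightarrow> 'a set \<Rightarrow> bool"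
  where "separates P z K \<longleftrightarrow> (SUP w\<in>K. ereal \<bar>P w\<bar>) < ereal \<bar>P z\<bar>"

end

theory Submission
  imports Defs
begin

text \<open>Average an even power of \<open>Q\<close> over the group: \<open>P x\<close> is the mean of \<open>\<gamma> \<mapsto> Q (\<gamma> x) ^ (2 k)\<close>. If
  \<open>\<bar>Q\<bar> \<le> s\<close> on \<open>K\<close> and \<open>s < t < \<bar>Q z\<bar>\<close>, then \<open>P \<le> s ^ (2 k)\<close> on \<open>K\<close> since \<open>K\<close> is invariant, while
  \<open>P z \<ge> \<delta> t ^ (2 k)\<close>, where \<open>\<delta> > 0\<close> bounds from below the weight of the neighbourhood
  \<open>{\<gamma>. \<bar>Q (\<gamma> z)\<bar> > t}\<close> of the identity; a large \<open>k\<close> separates. The invariant mean on continuous functions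
  is obtained in the manner of von Neumann, from constants that are uniform limits of finite averages of
  translates, so no Haar measure is needed. Averaging preserves polynomials because the polarization
  formula expresses a multilinear form through finitely many values of the polynomial, and continuity
  because the group is norm bounded by the uniform boundedness principle.\<close>

section \<open>Polynomials and polarization\<close>

lemma multilinear_formD:
  assumes "multilinear_form n A"
  shows "(\<And>i. i < n \<Longrightarrow> v i = w i) \<Longrightarrow> A v = A w"
    and "i < n \<Longrightarrow> linear (\<lambda>x. A (v(i := x)))"
  using assms unfolding multilinear_form_def by blast+

lemma multilinear_form_sum_upd:
  assumes "multilinear_form n A" "i < n"
  shows "A (v(i := \<Sum>j\<in>S. w j)) = (\<Sum>j\<in>S. A (v(i := w j)))"
  using linear_sum[OF multilinear_formD(2)[OF assms]] by simp

text \<open>Induction on the number \<open>m\<close> of slots filled with the sum. The other slots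
  are kept in an arbitrary \<open>u\<close>, so that the sum in slot \<open>m\<close> can first be
  absorbed into \<open>u\<close> and then be split by linearity.\<close>

lemma multilinear_form_expand:
  fixes S :: "'b set"
  assumes A: "multilinear_form n A" and S: "finite S" and "m \<le> n"
  shows "A (\<lambda>i. if i < m then \<Sum>j\<in>S. w j else u i) =
    (\<Sum>h\<in>{..<m} \<rightarrow>\<^sub>E S. A (\<lambda>i. if i < m then w (h i) else u i))"
  using \<open>m \<le> n\<close>
proof (induction m arbitrary: u)
  case 0
  then show ?case by simp
next
  case (Suc m)
  let ?s = "\<Sum>j\<in>S. w j"
  have upd: "(\<lambda>i. if i < Suc m then f i else u i) = (\<lambda>i. if i < m then f i else (u(m := f m)) i)"
    for f by (auto simp: less_Suc_eq)
  have "A (\<lambda>i. if i < Suc m then ?s else u i) =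
      (\<Sum>h\<in>{..<m} \<rightarrow>\<^sub>E S. A (\<lambda>i. if i < m then w (h i) else (u(m := ?s)) i))"
    unfolding upd using Suc.prems by (intro Suc.IH) simp
  also have "\<dots> = (\<Sum>h\<in>{..<m} \<rightarrow>\<^sub>E S. \<Sum>j\<in>S. A (\<lambda>i. if i < m then w (h i) else (u(m := w j)) i))"
  proof (rule sum.cong[OF refl])
    fix h
    have eq: "(\<lambda>i. if i < m then w (h i) else (u(m := x)) i) =
        (\<lambda>i. if i < m then w (h i) else u i)(m := x)" for x
      by auto
    show "A (\<lambda>i. if i < m then w (h i) else (u(m := ?s)) i) =
        (\<Sum>j\<in>S. A (\<lambda>i. if i < m then w (h i) else (u(m := w j)) i))"
      unfolding eq using Suc.prems by (intro multilinear_form_sum_upd[OF A]) simp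
  qed
  also have "\<dots> = (\<Sum>(j, h)\<in>S \<times> ({..<m} \<rightarrow>\<^sub>E S).
      A (\<lambda>i. if i < m then w (h i) else (u(m := w j)) i))"
    by (subst sum.swap) (simp add: sum.cartesian_product)
  \<comment> \<open>A map on \<open>{..<Suc m}\<close> is a map on \<open>{..<m}\<close> together
    with its value \<open>j\<close> at \<open>m\<close>.\<close>
  also have "\<dots> = (\<Sum>h\<in>(\<lambda>(j, h). h(m := j)) ` (S \<times> ({..<m} \<rightarrow>\<^sub>E S)).
      A (\<lambda>i. if i < Suc m then w (h i) else u i))"
  proof (subst sum.reindex)
    show "inj_on (\<lambda>(j, h). h(m := j)) (S \<times> ({..<m} \<rightarrow>\<^sub>E S))"
      using inj_combinator[of m "{..<m}" "\<lambda>_. S"] by simp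
    show "(\<Sum>(j, h)\<in>S \<times> ({..<m} \<rightarrow>\<^sub>E S). A (\<lambda>i. if i < m then w (h i) else (u(m := w j)) i)) =
        sum ((\<lambda>h. A (\<lambda>i. if i < Suc m then w (h i) else u i)) \<circ> (\<lambda>(j, h). h(m := j)))
          (S \<times> ({..<m} \<rightarrow>\<^sub>E S))"
    proof (rule sum.cong[OF refl])
      fix p :: "'b \<times> (nat \<Rightarrow> 'b)"
      obtain j h where p: "p = (j, h)" by force
      have "(\<lambda>i. if i < m then w (h i) else (u(m := w j)) i) =
          (\<lambda>i. if i < Suc m then w ((h(m := j)) i) else u i)"
        by (auto simp: less_Suc_eq)
      then show "(case p of (j, h) \<Rightarrow> A (\<lambda>i. if i < m then w (h i) else (u(m := w j)) i)) =
          ((\<lambda>h. A (\<lambda>i. if i < Suc m then w (h i) else u i)) \<circ> (\<lambda>(j, h). h(m := j))) p"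
        by (simp only: p o_apply prod.case)
    qed
  qed
  also have "(\<lambda>(j, h). h(m := j)) ` (S \<times> ({..<m} \<rightarrow>\<^sub>E S)) = {..<Suc m} \<rightarrow>\<^sub>E S"
    by (simp add: lessThan_Suc PiE_insert_eq)
  finally show ?case .
qed

text \<open>Extensionality keeps the set finite when \<open>S\<close> is; for
  \<open>S = {..<n}\<close> its members correspond to the permutations of
  \<open>{..<n}\<close>.\<close>

definition surjections :: "nat \<Rightarrow> nat set \<Rightarrow> (nat \<Rightarrow> nat) set"
  where "surjections n S = {h \<in> {..<n} \<rightarrow>\<^sub>E S. h ` {..<n} = S}"

text \<open>The denominator is \<open>n!\<close>.\<close>

definition polarization :: "nat \<Rightarrow> ('a::real_vector \<Rightarrow> real) \<Rightarrow> (nat \<Rightarrow> 'a) \<Rightarrow> real"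
  where "polarization n P v =
    (\<Sum>S\<in>Pow {..<n}. (-1) ^ (n - card S) * P (\<Sum>i\<in>S. v i)) / real (card (surjections n {..<n}))"

lemma finite_surjections: "finite S \<Longrightarrow> finite (surjections n S)"
  unfolding surjections_def by (rule finite_subset[of _ "{..<n} \<rightarrow>\<^sub>E S"]) (auto intro: finite_PiE)

lemma card_surjections_pos: "card (surjections n {..<n}) > 0"
proof -
  have "restrict id {..<n} \<in> surjections n {..<n}" by (auto simp: surjections_def)
  then show ?thesis using finite_surjections[of "{..<n}" n] by (auto simp: card_gt_0_iff)
qed

text \<open>Expanding \<open>P\<close> at a sum of vectors indexed by \<open>S\<close> gives a sum over all maps into \<open>S\<close>;
  inclusion-exclusion over \<open>S\<close> isolates the surjections, i.e. the permutations.\<close>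

lemma polarization_eq:
  assumes A: "multilinear_form n A" and P: "P = (\<lambda>x. A (\<lambda>_. x))"
  shows "polarization n P v =
    (\<Sum>h\<in>surjections n {..<n}. A (\<lambda>i. v (h i))) / real (card (surjections n {..<n}))"
proof -
  have expand: "P (\<Sum>j\<in>S. v j) = (\<Sum>T\<in>Pow S. \<Sum>h\<in>surjections n T. A (\<lambda>i. v (h i)))"
    if S: "finite S" for S
  proof -
    have "P (\<Sum>j\<in>S. v j) = A (\<lambda>i. if i < n then \<Sum>j\<in>S. v j else 0)"
      unfolding P by (rule multilinear_formD(1)[OF A]) simp
    also have "\<dots> = (\<Sum>h\<in>{..<n} \<rightarrow>\<^sub>E S. A (\<lambda>i. if i < n then v (h i) else 0))"
      by (rule multilinear_form_expand[OF A S]) simp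
    also have "\<dots> = (\<Sum>h\<in>{..<n} \<rightarrow>\<^sub>E S. A (\<lambda>i. v (h i)))"
      by (intro sum.cong refl multilinear_formD(1)[OF A]) simp
    also have "\<dots> = (\<Sum>T\<in>Pow S. \<Sum>h | h \<in> {..<n} \<rightarrow>\<^sub>E S \<and> h ` {..<n} = T. A (\<lambda>i. v (h i)))"
      using S by (intro sum.group[symmetric]) (auto intro: finite_PiE)
    also have "\<dots> = (\<Sum>T\<in>Pow S. \<Sum>h\<in>surjections n T. A (\<lambda>i. v (h i)))"
      by (intro sum.cong refl) (auto simp: surjections_def PiE_def Pi_def)
    finally show ?thesis .
  qed
  have "(\<Sum>h\<in>surjections n {..<n}. A (\<lambda>i. v (h i))) =
      (\<Sum>T\<in>Pow {..<n}. (-1) ^ (card {..<n} - card T) * P (\<Sum>j\<in>T. v j))"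
    by (rule inclusion_exclusion_mobius) (simp_all add: expand)
  then show ?thesis by (simp add: polarization_def)
qed

text \<open>On a constant tuple all summands in \<open>polarization_eq\<close> equal
  \<open>A (\<lambda>_. x)\<close>, and their mean is \<open>P x\<close>.\<close>

lemma polarization_diagonal:
  assumes "homogeneous_polynomial n P"
  shows "polarization n P (\<lambda>_. x) = P x"
proof -
  obtain A where "multilinear_form n A" "P = (\<lambda>x. A (\<lambda>_. x))"
    using assms unfolding homogeneous_polynomial_def by (auto simp: fun_eq_iff)
  then show ?thesis using polarization_eq[of n A P] card_surjections_pos[of n] by simp
qed

text \<open>By \<open>polarization_eq\<close> the polarization is the symmetrization of any form
  that represents \<open>P\<close>.\<close>

lemma multilinear_form_polarization:
  assumes "homogeneous_polynomial n P"
  shows "multilinear_form n (polarization n P)"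
proof -
  obtain A where A: "multilinear_form n A" and P: "P = (\<lambda>x. A (\<lambda>_. x))"
    using assms unfolding homogeneous_polynomial_def by (auto simp: fun_eq_iff)
  have "polarization n P v = polarization n P w" if "\<And>i. i < n \<Longrightarrow> v i = w i" for v w
    unfolding polarization_eq[OF A P] using that
    by (intro arg_cong2[where f = "(/)"] sum.cong refl multilinear_formD(1)[OF A])
      (auto simp: surjections_def PiE_def Pi_def)
  moreover have "linear (\<lambda>x. polarization n P (v(i := x)))" if i: "i < n" for i v
  proof -
    have "linear (\<lambda>x. A (\<lambda>j. (v(i := x)) (h j)))" if h: "h \<in> surjections n {..<n}" for h
    proof -
      \<comment> \<open>A surjection of \<open>{..<n}\<close> onto itself is a permutation, so
        exactly one slot \<open>k\<close> reads \<open>v\<close> at \<open>i\<close>, and changing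
        \<open>v i\<close> changes that slot alone.\<close>
      have img: "h ` {..<n} = {..<n}" using h by (simp add: surjections_def)
      then have inj: "inj_on h {..<n}" by (simp add: eq_card_imp_inj_on)
      obtain k where k: "k < n" "h k = i" using img i by (metis imageE lessThan_iff)
      have "A (\<lambda>j. (v(i := x)) (h j)) = A ((\<lambda>j. v (h j))(k := x))" for x
        using inj k by (intro multilinear_formD(1)[OF A]) (auto simp: inj_on_def)
      then show ?thesis using multilinear_formD(2)[OF A k(1), of "\<lambda>j. v (h j)"] by simp
    qed
    then have "linear (\<lambda>x. \<Sum>h\<in>surjections n {..<n}. A (\<lambda>j. (v(i := x)) (h j)))"
      by (intro linear_compose_sum) blast
    then have "linear (\<lambda>x. (1 / real (card (surjections n {..<n}))) *\<^sub>R
        (\<Sum>h\<in>surjections n {..<n}. A (\<lambda>j. (v(i := x)) (h j))))"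
      by (intro linear_compose_scale_right)
    then show ?thesis unfolding polarization_eq[OF A P] by simp
  qed
  ultimately show ?thesis unfolding multilinear_form_def by blast
qed

section \<open>Algebra of polynomials and continuity of their components\<close>

lemma homogeneous_polynomial_cmult:
  assumes "homogeneous_polynomial n P"
  shows "homogeneous_polynomial n (\<lambda>x. c * P x)"
proof -
  obtain A where A: "multilinear_form n A" and P: "\<And>x. P x = A (\<lambda>_. x)"
    using assms unfolding homogeneous_polynomial_def by blast
  have "multilinear_form n (\<lambda>v. c * A v)"
    using A linear_compose_scale_right[of _ c] unfolding multilinear_form_def by (fastforce simp: real_scaleR_def)
  then show ?thesis using P unfolding homogeneous_polynomial_def by auto
qed

lemma homogeneous_polynomial_add:
  assumes "homogeneous_polynomial n P" "homogeneous_polynomial n Q"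
  shows "homogeneous_polynomial n (\<lambda>x. P x + Q x)"
proof -
  obtain A B where A: "multilinear_form n A" "\<And>x. P x = A (\<lambda>_. x)"
    and B: "multilinear_form n B" "\<And>x. Q x = B (\<lambda>_. x)"
    using assms unfolding homogeneous_polynomial_def by metis
  have "multilinear_form n (\<lambda>v. A v + B v)"
    unfolding multilinear_form_def
  proof (intro conjI allI impI linear_compose_add)
    fix v w :: "nat \<Rightarrow> 'a" assume "\<forall>i<n. v i = w i"
    then show "A v + B v = A w + B w"
      using multilinear_formD(1)[OF A(1), of v w] multilinear_formD(1)[OF B(1), of v w] by simp
  qed (use A B multilinear_formD(2) in blast)+
  then show ?thesis using A(2) B(2) unfolding homogeneous_polynomial_def by auto
qed

lemma homogeneous_polynomial_zero: "homogeneous_polynomial n (\<lambda>_. 0)"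
  unfolding homogeneous_polynomial_def multilinear_form_def
  by (intro exI[of _ "\<lambda>_. 0"]) (simp add: linear_zero)

lemma homogeneous_polynomial_const: "homogeneous_polynomial 0 (\<lambda>_. c)"
  unfolding homogeneous_polynomial_def multilinear_form_def by (intro exI[of _ "\<lambda>_. c"]) simp

lemma homogeneous_polynomial_mult:
  assumes "homogeneous_polynomial m P" "homogeneous_polynomial n Q"
  shows "homogeneous_polynomial (m + n) (\<lambda>x. P x * Q x)"
proof -
  obtain A B where A: "multilinear_form m A" "\<And>x. P x = A (\<lambda>_. x)"
    and B: "multilinear_form n B" "\<And>x. Q x = B (\<lambda>_. x)"
    using assms unfolding homogeneous_polynomial_def by metis
  \<comment> \<open>The two forms read disjoint blocks of the tuple, so each slot belongs to one
    factor while the other stays constant.\<close>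
  define C where "C v = A v * B (\<lambda>i. v (m + i))" for v
  have cong: "C v = C w" if "\<And>i. i < m + n \<Longrightarrow> v i = w i" for v w
    unfolding C_def using that
    by (intro arg_cong2[where f = "(*)"] multilinear_formD(1)[OF A(1)] multilinear_formD(1)[OF B(1)]) auto
  have "linear (\<lambda>x. C (v(i := x)))" if i: "i < m + n" for i v
  proof (cases "i < m")
    case True
    have "C (v(i := x)) = B (\<lambda>i. v (m + i)) *\<^sub>R A (v(i := x))" for x
      using True by (simp add: C_def)
    then show ?thesis
      using linear_compose_scale_right[OF multilinear_formD(2)[OF A(1) True, of v]] by simp
  next
    case False
    have upd: "(\<lambda>j. (v(i := x)) (m + j)) = (\<lambda>j. v (m + j))(i - m := x)" for x
      using False by (auto simp: fun_eq_iff)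
    have "A (v(i := x)) = A v" for x
      using False by (intro multilinear_formD(1)[OF A(1)]) auto
    then have "C (v(i := x)) = A v *\<^sub>R B ((\<lambda>j. v (m + j))(i - m := x))" for x
      by (simp only: C_def upd real_scaleR_def)
    moreover have "i - m < n" using False i by simp
    ultimately show ?thesis
      using linear_compose_scale_right[OF multilinear_formD(2)[OF B(1), of "i - m" "\<lambda>j. v (m + j)"]]
      by simp
  qed
  with cong have "multilinear_form (m + n) C" unfolding multilinear_form_def by blast
  moreover have "P x * Q x = C (\<lambda>_. x)" for x by (simp add: C_def A(2) B(2))
  ultimately show ?thesis unfolding homogeneous_polynomial_def by blast
qed

lemma homogeneous_polynomial_power:
  assumes "homogeneous_polynomial n P"
  shows "homogeneous_polynomial (k * n) (\<lambda>x. P x ^ k)"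
proof (induction k)
  case 0
  then show ?case using homogeneous_polynomial_const by simp
next
  case (Suc k)
  then show ?case using homogeneous_polynomial_mult[OF assms Suc] by simp
qed

lemma homogeneous_polynomial_scaleR:
  assumes "homogeneous_polynomial n P"
  shows "P (c *\<^sub>R x) = c ^ n * P x"
proof -
  obtain A where A: "multilinear_form n A" and P: "\<And>x. P x = A (\<lambda>_. x)"
    using assms unfolding homogeneous_polynomial_def by blast
  \<comment> \<open>The scalar is pulled out of one slot at a time, by induction on the number of
    scaled slots.\<close>
  have "A (\<lambda>i. if i < m then c *\<^sub>R x else x) = c ^ m * A (\<lambda>_. x)" if "m \<le> n" for m
    using that
  proof (induction m)
    case (Suc m)
    let ?v = "\<lambda>i. if i < m then c *\<^sub>R x else x"
    have "A (\<lambda>i. if i < Suc m then c *\<^sub>R x else x) = A (?v(m := c *\<^sub>R x))"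
      by (intro multilinear_formD(1)[OF A]) (auto simp: less_Suc_eq)
    also have "\<dots> = c * A (?v(m := x))"
      using linear_scale[OF multilinear_formD(2)[OF A, of m ?v]] Suc.prems by simp
    also have "?v(m := x) = ?v" by auto
    finally show ?case using Suc by simp
  qed simp
  from this[of n] have "A (\<lambda>i. if i < n then c *\<^sub>R x else x) = c ^ n * A (\<lambda>_. x)" by simp
  moreover have "A (\<lambda>i. if i < n then c *\<^sub>R x else x) = A (\<lambda>_. c *\<^sub>R x)"
    by (intro multilinear_formD(1)[OF A]) simp
  ultimately show ?thesis by (simp add: P)
qed

lemma polynomial_on_space_homogeneous:
  assumes "homogeneous_polynomial n P"
  shows "polynomial_on_space P"
  unfolding polynomial_on_space_def
proof (intro exI conjI allI impI)
  show "homogeneous_polynomial k (if k = n then P else (\<lambda>_. 0))" for k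
    using assms homogeneous_polynomial_zero by auto
  show "P x = (\<Sum>k\<le>n. (if k = n then P else (\<lambda>_. 0)) x)" for x
    by (simp add: if_distribR)
qed

lemma polynomial_on_space_add:
  assumes "polynomial_on_space P" "polynomial_on_space Q"
  shows "polynomial_on_space (\<lambda>x. P x + Q x)"
proof -
  obtain m p n q where p: "\<And>k. k \<le> m \<Longrightarrow> homogeneous_polynomial k (p k)" "\<And>x. P x = (\<Sum>k\<le>m. p k x)"
    and q: "\<And>k. k \<le> n \<Longrightarrow> homogeneous_polynomial k (q k)" "\<And>x. Q x = (\<Sum>k\<le>n. q k x)"
    using assms unfolding polynomial_on_space_def by metis
  \<comment> \<open>Zero components pad both decompositions to the common degree bound
    \<open>m + n\<close>.\<close>
  define p' q' where "p' k = (if k \<le> m then p k else (\<lambda>_. 0))"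
    and "q' k = (if k \<le> n then q k else (\<lambda>_. 0))" for k
  have "homogeneous_polynomial k (\<lambda>x. p' k x + q' k x)" for k
    using p(1) q(1) homogeneous_polynomial_zero
    by (intro homogeneous_polynomial_add) (auto simp: p'_def q'_def)
  moreover have "P x + Q x = (\<Sum>k\<le>m + n. p' k x + q' k x)" for x
  proof -
    have "P x = (\<Sum>k\<le>m + n. p' k x)"
      unfolding p(2) by (rule sum.mono_neutral_cong_left) (auto simp: p'_def)
    moreover have "Q x = (\<Sum>k\<le>m + n. q' k x)"
      unfolding q(2) by (rule sum.mono_neutral_cong_left) (auto simp: q'_def)
    ultimately show ?thesis by (simp add: sum.distrib)
  qed
  ultimately show ?thesis unfolding polynomial_on_space_def
    by (intro exI[of _ "m + n"] exI[of _ "\<lambda>k x. p' k x + q' k x"]) simp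
qed

lemma polynomial_on_space_sum:
  assumes "finite I" "\<And>i. i \<in> I \<Longrightarrow> polynomial_on_space (P i)"
  shows "polynomial_on_space (\<lambda>x. \<Sum>i\<in>I. P i x)"
  using assms
proof (induction I rule: finite_induct)
  case empty
  then show ?case using polynomial_on_space_homogeneous homogeneous_polynomial_zero by auto
next
  case (insert i I)
  then show ?case by (simp add: polynomial_on_space_add)
qed

lemma polynomial_on_space_mult:
  assumes "polynomial_on_space P" "polynomial_on_space Q"
  shows "polynomial_on_space (\<lambda>x. P x * Q x)"
proof -
  obtain m p n q where p: "\<And>k. k \<le> m \<Longrightarrow> homogeneous_polynomial k (p k)" "\<And>x. P x = (\<Sum>k\<le>m. p k x)"
    and q: "\<And>k. k \<le> n \<Longrightarrow> homogeneous_polynomial k (q k)" "\<And>x. Q x = (\<Sum>k\<le>n. q k x)"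
    using assms unfolding polynomial_on_space_def by metis
  have "polynomial_on_space (\<lambda>x. \<Sum>i\<le>m. \<Sum>j\<le>n. p i x * q j x)"
    by (intro polynomial_on_space_sum)
      (auto intro!: polynomial_on_space_homogeneous homogeneous_polynomial_mult p(1) q(1))
  then show ?thesis by (simp add: p(2) q(2) sum_product)
qed

lemma polynomial_on_space_power:
  assumes "polynomial_on_space P"
  shows "polynomial_on_space (\<lambda>x. P x ^ k)"
proof (induction k)
  case 0
  then show ?case using polynomial_on_space_homogeneous homogeneous_polynomial_const by auto
next
  case (Suc k)
  then show ?case using polynomial_on_space_mult[OF assms Suc] by simp
qed

text \<open>A polynomial will be averaged component by component, and the mean is controlled on
  continuous functions, so continuity has to pass from the sum to each component. Induction on the
  degree bound.\<close>

lemma continuous_homogeneous_components: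
  fixes p :: "nat \<Rightarrow> 'a::real_normed_vector \<Rightarrow> real"
  assumes "\<And>k. k \<le> m \<Longrightarrow> homogeneous_polynomial k (p k)"
    and "continuous_on UNIV (\<lambda>x. \<Sum>k\<le>m. p k x)" and "k \<le> m"
  shows "continuous_on UNIV (p k)"
  using assms
proof (induction m arbitrary: p k)
  case 0
  then show ?case by simp
next
  case (Suc m)
  define R where "R x = (\<Sum>k\<le>Suc m. p k x)" for x
  define q where "q k x = (2 ^ k - 2 ^ Suc m) * p k x" for k x
  have R: "continuous_on UNIV R" using Suc.prems(2) by (simp add: R_def[abs_def])
  txt \<open>Comparing \<open>R (2 x)\<close> with \<open>2 ^ (m + 1) R x\<close> eliminates the component of top degree.\<close>
  have "(\<Sum>k\<le>m. q k x) = R (2 *\<^sub>R x) - 2 ^ Suc m * R x" for x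
  proof -
    have "R (2 *\<^sub>R x) = (\<Sum>k\<le>Suc m. 2 ^ k * p k x)"
      unfolding R_def using Suc.prems(1) by (intro sum.cong refl homogeneous_polynomial_scaleR) auto
    then show ?thesis
      by (simp add: R_def q_def sum_distrib_left sum_subtractf left_diff_distrib distrib_left)
  qed
  moreover have "continuous_on UNIV (\<lambda>x. R (2 *\<^sub>R x) - 2 ^ Suc m * R x)"
    by (intro continuous_intros R continuous_on_compose2[OF R]) auto
  ultimately have "continuous_on UNIV (\<lambda>x. \<Sum>k\<le>m. q k x)" by simp
  moreover have "homogeneous_polynomial k (q k)" if "k \<le> m" for k
    unfolding q_def[abs_def] using Suc.prems(1) that by (intro homogeneous_polynomial_cmult) simp
  ultimately have q: "continuous_on UNIV (q k)" if "k \<le> m" for k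
    using Suc.IH that by blast
  have low: "continuous_on UNIV (p k)" if "k \<le> m" for k
  proof -
    \<comment> \<open>The factor in \<open>q k\<close> is nonzero below the top degree and can be
      divided out.\<close>
    have "(2::real) ^ k < 2 ^ Suc m" using that by (intro power_strict_increasing) auto
    then have "p k x = q k x * (1 / (2 ^ k - 2 ^ Suc m))" for x by (simp add: q_def)
    then have "p k = (\<lambda>x. q k x * (1 / (2 ^ k - 2 ^ Suc m)))" by (rule ext)
    then show ?thesis using continuous_on_mult_right[OF q[OF that]] by (simp only:)
  qed
  have "p (Suc m) = (\<lambda>x. R x - (\<Sum>k\<le>m. p k x))" by (auto simp: R_def)
  then have "continuous_on UNIV (p (Suc m))"
    using low R by (auto intro!: continuous_intros)
  with low Suc.prems(3) show ?case by (cases "k = Suc m") auto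
qed

section \<open>The invariant mean of a compact group\<close>

lemma continuous_map_sum_list:
  fixes f :: "'b \<Rightarrow> 'c \<Rightarrow> real"
  assumes "\<And>a. a \<in> set L \<Longrightarrow> continuous_map X euclideanreal (f a)"
  shows "continuous_map X euclideanreal (\<lambda>x. \<Sum>a\<leftarrow>L. f a x)"
  using assms by (induction L) (auto intro!: continuous_map_add)

lemma sum_list_le_const:
  fixes f :: "'b \<Rightarrow> real"
  assumes "\<And>a. a \<in> set L \<Longrightarrow> f a \<le> c"
  shows "(\<Sum>a\<leftarrow>L. f a) \<le> real (length L) * c"
  using assms by (induction L) (auto simp: algebra_simps intro: add_mono)

lemma avg_le:
  fixes f :: "'b \<Rightarrow> real"
  assumes "L \<noteq> []" "\<And>a. a \<in> set L \<Longrightarrow> f a \<le> c"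
  shows "(\<Sum>a\<leftarrow>L. f a) / real (length L) \<le> c"
  using sum_list_le_const[OF assms(2)] assms(1) by (simp add: divide_le_eq mult.commute)

lemma avg_abs_diff_le:
  fixes f :: "'b \<Rightarrow> real"
  assumes "L \<noteq> []" "\<And>a. a \<in> set L \<Longrightarrow> \<bar>f a - c\<bar> \<le> \<epsilon>"
  shows "\<bar>(\<Sum>a\<leftarrow>L. f a) / real (length L) - c\<bar> \<le> \<epsilon>"
proof -
  have "(\<Sum>a\<leftarrow>L. f a) / real (length L) \<le> c + \<epsilon>"
    using assms(2) by (intro avg_le assms(1)) (force simp: abs_le_iff)
  moreover have "(\<Sum>a\<leftarrow>L. - f a) / real (length L) \<le> \<epsilon> - c"
    using assms(2) by (intro avg_le assms(1)) (force simp: abs_le_iff)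
  ultimately show ?thesis by (simp add: uminus_sum_list_map[unfolded o_def, symmetric] abs_le_iff)
qed

lemma sum_list_swap:
  fixes f :: "'b \<Rightarrow> 'c \<Rightarrow> real"
  shows "(\<Sum>a\<leftarrow>L. \<Sum>b\<leftarrow>M. f a b) = (\<Sum>b\<leftarrow>M. \<Sum>a\<leftarrow>L. f a b)"
  by (induction L) (auto simp: sum_list_addf)

section \<open>Finite averages of translates on a compact group\<close>

locale compact_topological_group = group G for G (structure) +
  fixes \<tau> :: "'a topology"
  assumes topspace_carrier: "topspace \<tau> = carrier G"
    and continuous_map_mult: "continuous_map (prod_topology \<tau> \<tau>) \<tau> (\<lambda>(x, y). x \<otimes> y)"
    and continuous_map_inv: "continuous_map \<tau> \<tau> (\<lambda>x. inv x)"
    and compact: "compact_space \<tau>"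
begin

abbreviation cont :: "('a \<Rightarrow> real) \<Rightarrow> bool"
  where "cont f \<equiv> continuous_map \<tau> euclideanreal f"

text \<open>Lists count repeated translates, so that averages compose exactly in
  \<open>ravg_ravg\<close> and \<open>lavg_lavg\<close> even when products coincide.\<close>

definition ravg :: "'a list \<Rightarrow> ('a \<Rightarrow> real) \<Rightarrow> 'a \<Rightarrow> real"
  where "ravg L f x = (\<Sum>a\<leftarrow>L. f (x \<otimes> a)) / real (length L)"

definition lavg :: "'a list \<Rightarrow> ('a \<Rightarrow> real) \<Rightarrow> 'a \<Rightarrow> real"
  where "lavg L f x = (\<Sum>a\<leftarrow>L. f (a \<otimes> x)) / real (length L)"

definition lists_in :: "'a list set"
  where "lists_in = {L. L \<noteq> [] \<and> set L \<subseteq> carrier G}"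

definition rmean :: "('a \<Rightarrow> real) \<Rightarrow> real \<Rightarrow> bool"
  where "rmean f c \<longleftrightarrow> (\<forall>\<epsilon>>0. \<exists>L\<in>lists_in. \<forall>x\<in>carrier G. \<bar>ravg L f x - c\<bar> \<le> \<epsilon>)"

definition lmean :: "('a \<Rightarrow> real) \<Rightarrow> real \<Rightarrow> bool"
  where "lmean f c \<longleftrightarrow> (\<forall>\<epsilon>>0. \<exists>L\<in>lists_in. \<forall>x\<in>carrier G. \<bar>lavg L f x - c\<bar> \<le> \<epsilon>)"

lemma continuous_map_mult_left: "a \<in> carrier G \<Longrightarrow> continuous_map \<tau> \<tau> (\<lambda>x. a \<otimes> x)"
  using continuous_map_compose[OF _ continuous_map_mult, of \<tau> "\<lambda>x. (a, x)"]
  by (simp add: continuous_map_pairwise o_def topspace_carrier)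

lemma continuous_map_mult_right: "a \<in> carrier G \<Longrightarrow> continuous_map \<tau> \<tau> (\<lambda>x. x \<otimes> a)"
  using continuous_map_compose[OF _ continuous_map_mult, of \<tau> "\<lambda>x. (x, a)"]
  by (simp add: continuous_map_pairwise o_def topspace_carrier)

lemma cont_translate_right: "cont f \<Longrightarrow> a \<in> carrier G \<Longrightarrow> cont (\<lambda>x. f (x \<otimes> a))"
  using continuous_map_compose[OF continuous_map_mult_right, of a euclideanreal f] by (simp add: o_def)

lemma cont_translate_left: "cont f \<Longrightarrow> a \<in> carrier G \<Longrightarrow> cont (\<lambda>x. f (a \<otimes> x))"
  using continuous_map_compose[OF continuous_map_mult_left, of a euclideanreal f] by (simp add: o_def)

lemma cont_ravg: "cont f \<Longrightarrow> set L \<subseteq> carrier G \<Longrightarrow> cont (ravg L f)"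
  unfolding ravg_def[abs_def] divide_inverse
  by (intro continuous_map_real_mult_right continuous_map_sum_list) (auto intro: cont_translate_right)

lemma cont_lavg: "cont f \<Longrightarrow> set L \<subseteq> carrier G \<Longrightarrow> cont (lavg L f)"
  unfolding lavg_def[abs_def] divide_inverse
  by (intro continuous_map_real_mult_right continuous_map_sum_list) (auto intro: cont_translate_left)

lemma lists_inD: "L \<in> lists_in \<Longrightarrow> L \<noteq> []" "L \<in> lists_in \<Longrightarrow> a \<in> set L \<Longrightarrow> a \<in> carrier G"
  "L \<in> lists_in \<Longrightarrow> set L \<subseteq> carrier G"
  by (auto simp: lists_in_def)

lemma ravg_abs_diff_le:
  assumes "L \<in> lists_in" "\<And>y. y \<in> carrier G \<Longrightarrow> \<bar>f y - c\<bar> \<le> \<epsilon>" "x \<in> carrier G"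
  shows "\<bar>ravg L f x - c\<bar> \<le> \<epsilon>"
  unfolding ravg_def using assms by (intro avg_abs_diff_le) (auto simp: lists_in_def)

lemma lavg_abs_diff_le:
  assumes "L \<in> lists_in" "\<And>y. y \<in> carrier G \<Longrightarrow> \<bar>f y - c\<bar> \<le> \<epsilon>" "x \<in> carrier G"
  shows "\<bar>lavg L f x - c\<bar> \<le> \<epsilon>"
  unfolding lavg_def using assms by (intro avg_abs_diff_le) (auto simp: lists_in_def)

lemma lavg_add: "lavg L (\<lambda>x. f x + g x) x = lavg L f x + lavg L g x"
  by (simp add: lavg_def sum_list_addf add_divide_distrib)

lemma lavg_cmult: "lavg L (\<lambda>x. c * f x) x = c * lavg L f x"
  by (simp add: lavg_def sum_list_const_mult)

text \<open>Left and right translations commute by associativity. Uniqueness and invariance of the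
  mean both rest on this.\<close>

lemma ravg_lavg_commute:
  assumes "L \<in> lists_in" "M \<in> lists_in" "x \<in> carrier G"
  shows "ravg L (lavg M f) x = lavg M (ravg L f) x"
proof -
  have eq: "(\<Sum>a\<leftarrow>L. \<Sum>b\<leftarrow>M. f (b \<otimes> (x \<otimes> a))) = (\<Sum>a\<leftarrow>L. \<Sum>b\<leftarrow>M. f (b \<otimes> x \<otimes> a))"
    using assms by (intro arg_cong[where f=sum_list] map_cong refl) (auto simp: m_assoc lists_in_def subset_eq)
  have "ravg L (lavg M f) x =
      (\<Sum>a\<leftarrow>L. \<Sum>b\<leftarrow>M. f (b \<otimes> (x \<otimes> a))) / (real (length M) * real (length L))"
    by (simp add: ravg_def lavg_def divide_inverse sum_list_mult_const mult.assoc)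
  also have "\<dots> = (\<Sum>b\<leftarrow>M. \<Sum>a\<leftarrow>L. f (b \<otimes> x \<otimes> a)) / (real (length M) * real (length L))"
    unfolding eq by (subst sum_list_swap) simp
  also have "\<dots> = lavg M (ravg L f) x"
    by (simp add: ravg_def lavg_def divide_inverse sum_list_mult_const sum_list_const_mult mult_ac)
  finally show ?thesis .
qed

definition list_mult :: "'a list \<Rightarrow> 'a list \<Rightarrow> 'a list"
  where "list_mult L M = concat (map (\<lambda>a. map (\<lambda>b. a \<otimes> b) M) L)"

lemma length_list_mult: "length (list_mult L M) = length L * length M"
  by (induction L) (auto simp: list_mult_def)

lemma list_mult_in: "L \<in> lists_in \<Longrightarrow> M \<in> lists_in \<Longrightarrow> list_mult L M \<in> lists_in"
  by (auto simp: list_mult_def lists_in_def)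

lemma sum_list_list_mult:
  fixes f :: "'a \<Rightarrow> real"
  shows "(\<Sum>c\<leftarrow>list_mult L M. f c) = (\<Sum>a\<leftarrow>L. \<Sum>b\<leftarrow>M. f (a \<otimes> b))"
  by (induction L) (auto simp: list_mult_def o_def)

lemma ravg_ravg:
  assumes "L \<in> lists_in" "M \<in> lists_in" "x \<in> carrier G"
  shows "ravg L (ravg M f) x = ravg (list_mult L M) f x"
proof -
  have "(\<Sum>a\<leftarrow>L. \<Sum>b\<leftarrow>M. f (x \<otimes> a \<otimes> b)) = (\<Sum>a\<leftarrow>L. \<Sum>b\<leftarrow>M. f (x \<otimes> (a \<otimes> b)))"
    using assms by (intro arg_cong[where f=sum_list] map_cong refl) (auto simp: m_assoc lists_in_def subset_eq)
  then show ?thesis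
    by (simp add: ravg_def sum_list_list_mult length_list_mult divide_inverse sum_list_mult_const sum_list_const_mult mult_ac)
qed

text \<open>The order of the lists is reversed because the inner average multiplies from the left
  last, giving the products \<open>b \<otimes> a\<close>.\<close>

lemma lavg_lavg:
  assumes "L \<in> lists_in" "M \<in> lists_in" "x \<in> carrier G"
  shows "lavg L (lavg M f) x = lavg (list_mult M L) f x"
proof -
  have "(\<Sum>a\<leftarrow>L. \<Sum>b\<leftarrow>M. f (b \<otimes> (a \<otimes> x))) = (\<Sum>a\<leftarrow>L. \<Sum>b\<leftarrow>M. f (b \<otimes> a \<otimes> x))"
    using assms by (intro arg_cong[where f=sum_list] map_cong refl) (auto simp: m_assoc lists_in_def subset_eq)
  also have "\<dots> = (\<Sum>b\<leftarrow>M. \<Sum>a\<leftarrow>L. f (b \<otimes> a \<otimes> x))"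
    by (rule sum_list_swap)
  finally show ?thesis
    by (simp add: lavg_def sum_list_list_mult length_list_mult divide_inverse sum_list_mult_const sum_list_const_mult mult_ac)
qed

section \<open>Compactness: finite covers by translates, uniform continuity, existence of
  means\<close>

lemma finite_translate_cover:
  assumes U: "openin \<tau> U" "\<one> \<in> U"
  obtains A where "A \<in> lists_in" "\<And>x. x \<in> carrier G \<Longrightarrow> \<exists>a\<in>set A. x \<otimes> inv a \<in> U"
proof -
  \<comment> \<open>\<open>V a\<close> is the right translate of \<open>U\<close> by
    \<open>a\<close>; it contains \<open>a\<close> because \<open>U\<close> contains the identity,
    so these open sets cover the group.\<close>
  define V where "V a = {x \<in> topspace \<tau>. x \<otimes> inv a \<in> U}" for a
  have "openin \<tau> (V a)" if "a \<in> carrier G" for a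
    unfolding V_def
    by (rule openin_continuous_map_preimage[OF continuous_map_mult_right U(1)]) (simp add: that)
  moreover have "topspace \<tau> \<subseteq> \<Union>(V ` carrier G)"
    using U by (force simp: V_def topspace_carrier)
  ultimately obtain \<F> where F: "finite \<F>" "\<F> \<subseteq> V ` carrier G" "topspace \<tau> \<subseteq> \<Union>\<F>"
    using compact unfolding compact_space_alt by (metis (no_types, lifting) imageE)
  then obtain B where B: "B \<subseteq> carrier G" "finite B" "\<F> = V ` B"
    by (meson finite_subset_image)
  then obtain A where A: "set A = B" using finite_list by blast
  \<comment> \<open>The identity is covered, so the list of translates is nonempty, as
    \<open>lists_in\<close> demands.\<close>
  have "\<one> \<in> \<Union>(V ` B)" using F B topspace_carrier by auto
  then have "A \<in> lists_in" using A B by (auto simp: lists_in_def)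
  moreover have "\<exists>a\<in>set A. x \<otimes> inv a \<in> U" if "x \<in> carrier G" for x
    using that F B A by (auto simp: V_def topspace_carrier)
  ultimately show ?thesis using that by blast
qed

text \<open>The difference is jointly continuous in \<open>u\<close> and \<open>x\<close> and
  vanishes for \<open>u = \<one>\<close>; the tube lemma along the compact group makes the
  neighbourhood of \<open>\<one>\<close> uniform in \<open>x\<close>.\<close>

lemma left_uniformly_continuous:
  assumes f: "cont f" and "\<epsilon> > 0"
  obtains U where "openin \<tau> U" "\<one> \<in> U"
    "\<And>u x. u \<in> U \<Longrightarrow> x \<in> carrier G \<Longrightarrow> \<bar>f (u \<otimes> x) - f x\<bar> < \<epsilon>"
proof -
  define W where "W = {p \<in> topspace (prod_topology \<tau> \<tau>). \<bar>f (fst p \<otimes> snd p) - f (snd p)\<bar> \<in> {..<\<epsilon>}}"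
  have "continuous_map (prod_topology \<tau> \<tau>) euclideanreal (\<lambda>p. f (fst p \<otimes> snd p))"
    using continuous_map_compose[OF continuous_map_mult f] by (simp add: o_def case_prod_beta)
  moreover have "continuous_map (prod_topology \<tau> \<tau>) euclideanreal (\<lambda>p. f (snd p))"
    using continuous_map_compose[OF continuous_map_snd f] by (simp add: o_def)
  ultimately have "continuous_map (prod_topology \<tau> \<tau>) euclideanreal
      (\<lambda>p. \<bar>f (fst p \<otimes> snd p) - f (snd p)\<bar>)"
    by (intro continuous_map_real_abs continuous_map_diff)
  then have "openin (prod_topology \<tau> \<tau>) W"
    unfolding W_def by (rule openin_continuous_map_preimage) simp
  moreover have "compactin \<tau> (carrier G)" using compact by (simp add: compact_space_def topspace_carrier)
  moreover have "{\<one>} \<times> carrier G \<subseteq> W" using \<open>\<epsilon> > 0\<close> by (auto simp: W_def topspace_carrier)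
  ultimately obtain U V where "openin \<tau> U" "\<one> \<in> U" "carrier G \<subseteq> V" "U \<times> V \<subseteq> W"
    using tube_lemma_right[of \<tau> \<tau> W "carrier G" \<one>] by (auto simp: topspace_carrier)
  moreover from this have "\<bar>f (u \<otimes> x) - f x\<bar> < \<epsilon>" if "u \<in> U" "x \<in> carrier G" for u x
    using that by (force simp: W_def)
  ultimately show ?thesis using that by blast
qed

lemma cont_bounded:
  assumes "cont f"
  obtains B where "\<And>x. x \<in> carrier G \<Longrightarrow> \<bar>f x\<bar> \<le> B"
proof -
  have "compact (f ` carrier G)"
    using image_compactin[OF _ assms, of "carrier G"] compact
    by (simp add: compact_space_def topspace_carrier)
  then show ?thesis using that compact_imp_bounded bounded_iff by (metis imageI real_norm_def)
qed

text \<open>Let \<open>s\<close> be the infimum of the suprema of the right averages of \<open>f\<close> and let \<open>g\<close> be a right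
  average with \<open>g \<le> s + \<eta>\<close>. All right averages of \<open>f\<close> share the modulus of left uniform continuity
  of \<open>f\<close>, so a small value \<open>g(y)\<close> is spread by a further average over \<open>N\<close> translates, with \<open>N\<close>
  depending on \<open>\<epsilon>\<close> alone. That average still exceeds \<open>s - \<eta>\<close> somewhere, which bounds \<open>g(y)\<close> from
  below by \<open>s - 2 N \<eta> - \<epsilon>\<close>.\<close>

lemma ex_rmean:
  assumes f: "cont f"
  shows "\<exists>c. rmean f c"
proof -
  define C where "C = {c. \<exists>L\<in>lists_in. \<forall>x\<in>carrier G. ravg L f x \<le> c}"
  define s where "s = Inf C"
  obtain B where B: "\<And>x. x \<in> carrier G \<Longrightarrow> \<bar>f x\<bar> \<le> B" using cont_bounded[OF f] by blast
  have avgB: "\<bar>ravg L f x - 0\<bar> \<le> B" if "L \<in> lists_in" "x \<in> carrier G" for L x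
    using that B by (intro ravg_abs_diff_le) auto
  have one: "[\<one>] \<in> lists_in" by (simp add: lists_in_def)
  have "ravg [\<one>] f x \<le> B" if "x \<in> carrier G" for x
    using avgB[OF one that] by (simp only: diff_0_right abs_le_iff)
  then have "B \<in> C" using one unfolding C_def by blast
  then have Cne: "C \<noteq> {}" by blast
  have Cbd: "bdd_below C"
  proof (rule bdd_belowI[of _ "-B"])
    fix c assume "c \<in> C"
    then obtain L where "L \<in> lists_in" "ravg L f \<one> \<le> c" unfolding C_def using one_closed by blast
    then show "-B \<le> c" using avgB[of L \<one>] by auto
  qed
  have "\<exists>L\<in>lists_in. \<forall>x\<in>carrier G. \<bar>ravg L f x - s\<bar> \<le> \<epsilon>" if \<epsilon>: "\<epsilon> > 0" for \<epsilon>
  proof -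
    obtain U where U: "openin \<tau> U" "\<one> \<in> U"
      "\<And>u x. u \<in> U \<Longrightarrow> x \<in> carrier G \<Longrightarrow> \<bar>f (u \<otimes> x) - f x\<bar> < \<epsilon>/2"
      using left_uniformly_continuous[OF f, of "\<epsilon>/2"] \<open>\<epsilon> > 0\<close> by auto
    have Ucar: "U \<subseteq> carrier G" using U(1) openin_subset topspace_carrier by auto
    obtain A where A: "A \<in> lists_in" "\<And>x. x \<in> carrier G \<Longrightarrow> \<exists>a\<in>set A. x \<otimes> inv a \<in> U"
      using finite_translate_cover[OF U(1,2)] by blast
    define N where "N = real (length A)"
    have N: "N \<ge> 1" using A(1) by (cases A) (auto simp: N_def lists_in_def)
    \<comment> \<open>The lower bound for \<open>g y\<close> will lose less than
      \<open>2 * N * \<eta>\<close> through the average and \<open>\<epsilon>/2\<close> through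
      uniform continuity; this choice keeps the total within \<open>\<epsilon>\<close>.\<close>
    define \<eta> where "\<eta> = \<epsilon> / (4 * N)"
    have \<eta>: "\<eta> > 0" "\<eta> \<le> \<epsilon>" "2 * N * \<eta> = \<epsilon> / 2"
      using N \<open>\<epsilon> > 0\<close> by (auto simp: \<eta>_def field_simps)
    obtain c where "c \<in> C" "c < s + \<eta>"
      using cInf_lessD[OF Cne, of "s + \<eta>"] \<eta>(1) by (auto simp: s_def)
    then obtain L where L: "L \<in> lists_in" "\<And>x. x \<in> carrier G \<Longrightarrow> ravg L f x \<le> s + \<eta>"
      unfolding C_def by (smt (verit, best) mem_Collect_eq)
    define g where "g = ravg L f"
    have g_unif: "g (u \<otimes> x) \<le> g x + \<epsilon>/2" if "u \<in> U" "x \<in> carrier G" for u x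
    proof -
      have "(\<Sum>a\<leftarrow>L. f (u \<otimes> x \<otimes> a) - f (x \<otimes> a)) / real (length L) \<le> \<epsilon>/2"
      proof (rule avg_le)
        fix a assume "a \<in> set L"
        then have "a \<in> carrier G" using L lists_inD by blast
        then have "\<bar>f (u \<otimes> (x \<otimes> a)) - f (x \<otimes> a)\<bar> < \<epsilon>/2" "u \<otimes> x \<otimes> a = u \<otimes> (x \<otimes> a)"
          using U(3) that Ucar m_assoc by auto
        then show "f (u \<otimes> x \<otimes> a) - f (x \<otimes> a) \<le> \<epsilon>/2"
          by (simp only:)
      qed (use L lists_inD in auto)
      then show ?thesis
        unfolding g_def ravg_def sum_list_subtractf diff_divide_distrib by linarith
    qed
    have "\<bar>g y - s\<bar> \<le> \<epsilon>" if y: "y \<in> carrier G" for y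
    proof -
      \<comment> \<open>For every \<open>x\<close> some \<open>a\<close> in \<open>A\<close> puts
        \<open>x \<otimes> inv a\<close> in \<open>U\<close>, so the average over \<open>D\<close>
        always samples \<open>g\<close> at a point of the form \<open>u \<otimes> y\<close> with
        \<open>u\<close> in \<open>U\<close>.\<close>
      define D where "D = map (\<lambda>a. inv a \<otimes> y) A"
      have D: "D \<in> lists_in" using A(1) y by (auto simp: D_def lists_in_def)
      \<comment> \<open>A right average of \<open>g\<close> is again a right average of
        \<open>f\<close>, so such a bound would put \<open>s - \<eta>\<close> in \<open>C\<close>,
        below its infimum.\<close>
      have "\<not> (\<forall>x\<in>carrier G. ravg D g x \<le> s - \<eta>)"
      proof
        assume "\<forall>x\<in>carrier G. ravg D g x \<le> s - \<eta>"
        then have "s - \<eta> \<in> C"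
          using list_mult_in[OF D L(1)] ravg_ravg[OF D L(1)] by (auto simp: C_def g_def)
        then show False using cInf_lower[OF _ Cbd, of "s - \<eta>"] \<eta>(1) by (auto simp: s_def)
      qed
      then obtain x where x: "x \<in> carrier G" "ravg D g x > s - \<eta>" by auto
      obtain a where a: "a \<in> set A" "x \<otimes> inv a \<in> U" using A(2)[OF x(1)] by blast
      have acar: "b \<in> carrier G" if "b \<in> set A" for b using that A(1) lists_inD by blast
      have small: "g (x \<otimes> (inv a \<otimes> y)) \<le> g y + \<epsilon>/2"
        using g_unif[OF a(2) y] acar[OF a(1)] x(1) y by (simp add: m_assoc)
      \<comment> \<open>The term at \<open>a\<close> is controlled by \<open>g y\<close>; each of
        the \<open>N - 1\<close> others is at most \<open>s + \<eta>\<close>.\<close>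
      have "(\<Sum>b\<leftarrow>A. g (x \<otimes> (inv b \<otimes> y))) =
          g (x \<otimes> (inv a \<otimes> y)) + (\<Sum>b\<leftarrow>remove1 a A. g (x \<otimes> (inv b \<otimes> y)))"
        using a(1) by (rule sum_list_map_remove1)
      also have "\<dots> \<le> (g y + \<epsilon>/2) + real (length (remove1 a A)) * (s + \<eta>)"
      proof (intro add_mono sum_list_le_const small)
        fix b assume "b \<in> set (remove1 a A)"
        then have "b \<in> carrier G" using acar set_remove1_subset by fastforce
        then show "g (x \<otimes> (inv b \<otimes> y)) \<le> s + \<eta>" using L(2) x(1) y by (simp add: g_def)
      qed
      also have "real (length (remove1 a A)) = N - 1"
        using a(1) unfolding length_remove1 N_def by (cases A) auto
      finally have "ravg D g x * N \<le> (g y + \<epsilon>/2) + (N - 1) * (s + \<eta>)"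
        using N by (simp add: ravg_def D_def o_def N_def[symmetric])
      moreover have "(s - \<eta>) * N \<le> ravg D g x * N" using x(2) N by (intro mult_right_mono) auto
      ultimately have "s - 2 * N * \<eta> + \<eta> - \<epsilon>/2 \<le> g y" by (simp add: algebra_simps)
      then have "s - \<epsilon> \<le> g y" using \<eta> by linarith
      moreover have "g y \<le> s + \<epsilon>" using L(2)[OF y] \<eta>(2) by (simp add: g_def)
      ultimately show ?thesis by (simp add: abs_le_iff)
    qed
    then show ?thesis using L(1) by (auto simp: g_def)
  qed
  then have "rmean f s" by (simp add: rmean_def)
  then show ?thesis ..
qed

text \<open>Inversion exchanges left and right translations, so a right mean of
  \<open>\<lambda>x. f (inv x)\<close> is a left mean of \<open>f\<close>.\<close>

lemma ex_lmean:
  assumes f: "cont f"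
  shows "\<exists>c. lmean f c"
proof -
  have "cont (\<lambda>x. f (inv x))"
    using continuous_map_compose[OF continuous_map_inv f] by (simp add: o_def)
  then obtain c where c: "rmean (\<lambda>x. f (inv x)) c" using ex_rmean by blast
  have "\<exists>M\<in>lists_in. \<forall>x\<in>carrier G. \<bar>lavg M f x - c\<bar> \<le> \<epsilon>" if \<epsilon>: "\<epsilon> > 0" for \<epsilon>
  proof -
    obtain L where L: "L \<in> lists_in" "\<And>x. x \<in> carrier G \<Longrightarrow> \<bar>ravg L (\<lambda>x. f (inv x)) x - c\<bar> \<le> \<epsilon>"
      using c \<epsilon> unfolding rmean_def by blast
    define M where "M = map (\<lambda>a. inv a) L"
    have M: "M \<in> lists_in" using L(1) by (auto simp: M_def lists_in_def)
    have "lavg M f x = ravg L (\<lambda>x. f (inv x)) (inv x)" if "x \<in> carrier G" for x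
    proof -
      have "(\<Sum>a\<leftarrow>L. f (inv a \<otimes> x)) = (\<Sum>a\<leftarrow>L. f (inv (inv x \<otimes> a)))"
        using L(1) that
        by (intro arg_cong[where f=sum_list] map_cong refl) (auto simp: inv_mult_group lists_in_def subset_eq)
      then show ?thesis by (simp add: lavg_def ravg_def M_def o_def)
    qed
    moreover have "\<bar>ravg L (\<lambda>x. f (inv x)) (inv x) - c\<bar> \<le> \<epsilon>" if "x \<in> carrier G" for x
      using L(2) that by simp
    ultimately show ?thesis using M by (intro bexI[of _ M]) auto
  qed
  then show ?thesis unfolding lmean_def by blast
qed

text \<open>An average of a function close to a constant is still close to it. The double average is
  therefore near \<open>d\<close> in one order and near \<open>c\<close> in the other, and the two
  orders agree. As both kinds of mean exist for continuous \<open>f\<close>, each is unique.\<close>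

lemma rmean_lmean_unique:
  assumes "rmean f c" "lmean f d"
  shows "c = d"
proof (rule ccontr)
  assume "c \<noteq> d"
  define \<epsilon> where "\<epsilon> = \<bar>c - d\<bar> / 3"
  have "\<epsilon> > 0" using \<open>c \<noteq> d\<close> by (simp add: \<epsilon>_def)
  obtain L where L: "L \<in> lists_in" "\<And>x. x \<in> carrier G \<Longrightarrow> \<bar>ravg L f x - c\<bar> \<le> \<epsilon>"
    using assms(1) \<open>\<epsilon> > 0\<close> unfolding rmean_def by blast
  obtain M where M: "M \<in> lists_in" "\<And>x. x \<in> carrier G \<Longrightarrow> \<bar>lavg M f x - d\<bar> \<le> \<epsilon>"
    using assms(2) \<open>\<epsilon> > 0\<close> unfolding lmean_def by blast
  have "\<bar>ravg L (lavg M f) \<one> - d\<bar> \<le> \<epsilon>" using L M by (intro ravg_abs_diff_le) auto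
  moreover have "\<bar>lavg M (ravg L f) \<one> - c\<bar> \<le> \<epsilon>" using L M by (intro lavg_abs_diff_le) auto
  ultimately have "\<bar>c - d\<bar> \<le> 2 * \<epsilon>" using ravg_lavg_commute[OF L(1) M(1), of \<one> f] by auto
  then show False using \<open>\<epsilon> > 0\<close> by (simp add: \<epsilon>_def)
qed

text \<open>Meaningful for continuous functions only; otherwise the description may be vacuous.\<close>

definition mean :: "('a \<Rightarrow> real) \<Rightarrow> real"
  where "mean f = (THE c. lmean f c)"

lemma lmean_iff:
  assumes "cont f"
  shows "lmean f c \<longleftrightarrow> c = mean f"
proof -
  obtain a b where "rmean f a" "lmean f b" using ex_rmean ex_lmean assms by blast
  then have "lmean f = (\<lambda>c. c = b)" using rmean_lmean_unique by blast
  then show ?thesis by (simp add: mean_def)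
qed

lemma rmean_iff:
  assumes "cont f"
  shows "rmean f c \<longleftrightarrow> c = mean f"
  by (metis assms ex_rmean lmean_iff rmean_lmean_unique)

section \<open>Invariance, linearity and positivity of the mean\<close>

lemma mean_ravg:
  assumes f: "cont f" and L: "L \<in> lists_in"
  shows "mean (ravg L f) = mean f"
proof -
  have "\<exists>M\<in>lists_in. \<forall>x\<in>carrier G. \<bar>lavg M (ravg L f) x - mean f\<bar> \<le> \<epsilon>" if \<epsilon>: "\<epsilon> > 0" for \<epsilon>
  proof -
    have "lmean f (mean f)" by (simp add: lmean_iff f)
    then obtain M where M: "M \<in> lists_in" "\<And>x. x \<in> carrier G \<Longrightarrow> \<bar>lavg M f x - mean f\<bar> \<le> \<epsilon>"
      using \<epsilon> unfolding lmean_def by blast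
    \<comment> \<open>After commuting, the right average acts on a function already close to
      \<open>mean f\<close>.\<close>
    have "\<bar>lavg M (ravg L f) x - mean f\<bar> \<le> \<epsilon>" if "x \<in> carrier G" for x
      unfolding ravg_lavg_commute[OF L M(1) that, symmetric]
      by (rule ravg_abs_diff_le[OF L M(2) that])
    then show ?thesis using M(1) by blast
  qed
  then have "lmean (ravg L f) (mean f)" by (simp add: lmean_def)
  then show ?thesis using lmean_iff[of "ravg L f"] cont_ravg f L lists_inD(3) by simp
qed

text \<open>The mirror image of \<open>mean_ravg\<close>, using that the right mean is the same
  number. It serves the proof of additivity.\<close>

lemma mean_lavg:
  assumes f: "cont f" and L: "L \<in> lists_in"
  shows "mean (lavg L f) = mean f"
proof -
  have "\<exists>M\<in>lists_in. \<forall>x\<in>carrier G. \<bar>ravg M (lavg L f) x - mean f\<bar> \<le> \<epsilon>" if \<epsilon>: "\<epsilon> > 0" for \<epsilon>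
  proof -
    have "rmean f (mean f)" by (simp add: rmean_iff f)
    then obtain M where M: "M \<in> lists_in" "\<And>x. x \<in> carrier G \<Longrightarrow> \<bar>ravg M f x - mean f\<bar> \<le> \<epsilon>"
      using \<epsilon> unfolding rmean_def by blast
    have "\<bar>ravg M (lavg L f) x - mean f\<bar> \<le> \<epsilon>" if "x \<in> carrier G" for x
      unfolding ravg_lavg_commute[OF M(1) L that]
      by (rule lavg_abs_diff_le[OF L M(2) that])
    then show ?thesis using M(1) by blast
  qed
  then have "rmean (lavg L f) (mean f)" by (simp add: rmean_def)
  then show ?thesis using rmean_iff[of "lavg L f"] cont_lavg f L lists_inD(3) by simp
qed

lemma mean_translate:
  assumes "cont f" "a \<in> carrier G"
  shows "mean (\<lambda>x. f (x \<otimes> a)) = mean f"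
  using mean_ravg[of f "[a]"] assms by (simp add: lists_in_def ravg_def[abs_def])

lemma mean_add:
  assumes f: "cont f" and g: "cont g"
  shows "mean (\<lambda>x. f x + g x) = mean f + mean g"
proof -
  have "\<exists>N\<in>lists_in. \<forall>x\<in>carrier G. \<bar>lavg N (\<lambda>x. f x + g x) x - (mean f + mean g)\<bar> \<le> \<epsilon>"
    if \<epsilon>: "\<epsilon> > 0" for \<epsilon>
  proof -
    have half: "\<epsilon>/2 > 0" using \<epsilon> by simp
    have "lmean f (mean f)" by (simp add: lmean_iff f)
    then obtain L where L: "L \<in> lists_in" "\<And>x. x \<in> carrier G \<Longrightarrow> \<bar>lavg L f x - mean f\<bar> \<le> \<epsilon>/2"
      using half unfolding lmean_def by blast
    \<comment> \<open>One list must serve both functions: \<open>L\<close> is chosen for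
      \<open>f\<close>, then \<open>M\<close> for \<open>lavg L g\<close>, whose mean is still
      \<open>mean g\<close>. Averaging \<open>lavg L f\<close> further over \<open>M\<close> does
      not spoil its estimate.\<close>
    have "lmean (lavg L g) (mean g)"
      using lmean_iff[OF cont_lavg[OF g lists_inD(3)[OF L(1)]]] mean_lavg[OF g L(1)] by simp
    then obtain M where M: "M \<in> lists_in" "\<And>x. x \<in> carrier G \<Longrightarrow> \<bar>lavg M (lavg L g) x - mean g\<bar> \<le> \<epsilon>/2"
      using half unfolding lmean_def by blast
    have "\<bar>lavg (list_mult L M) (\<lambda>x. f x + g x) x - (mean f + mean g)\<bar> \<le> \<epsilon>"
      if "x \<in> carrier G" for x
    proof -
      have "\<bar>lavg M (lavg L f) x - mean f\<bar> \<le> \<epsilon>/2"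
        using M(1) L(2) that by (rule lavg_abs_diff_le)
      then show ?thesis
        using M(2)[OF that] unfolding lavg_add lavg_lavg[OF M(1) L(1) that] by linarith
    qed
    then show ?thesis using list_mult_in L(1) M(1) by blast
  qed
  then have "lmean (\<lambda>x. f x + g x) (mean f + mean g)" by (simp add: lmean_def)
  then show ?thesis using lmean_iff[of "\<lambda>x. f x + g x"] f g by (simp add: continuous_map_add)
qed

lemma mean_const: "mean (\<lambda>_. c) = c"
proof -
  have "lmean (\<lambda>_. c) c" unfolding lmean_def
    by (intro allI impI bexI[of _ "[\<one>]"]) (auto simp: lists_in_def lavg_def)
  then show ?thesis using lmean_iff[of "\<lambda>_. c"] by simp
qed

lemma mean_cmult:
  assumes f: "cont f"
  shows "mean (\<lambda>x. c * f x) = c * mean f"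
proof -
  have "\<exists>L\<in>lists_in. \<forall>x\<in>carrier G. \<bar>lavg L (\<lambda>x. c * f x) x - c * mean f\<bar> \<le> \<epsilon>" if \<epsilon>: "\<epsilon> > 0" for \<epsilon>
  proof -
    have "lmean f (mean f)" by (simp add: lmean_iff f)
    \<comment> \<open>Adding 1 avoids a division by zero when \<open>c = 0\<close>.\<close>
    moreover have "\<epsilon> / (\<bar>c\<bar> + 1) > 0" using that by simp
    ultimately obtain L where L: "L \<in> lists_in"
      "\<And>x. x \<in> carrier G \<Longrightarrow> \<bar>lavg L f x - mean f\<bar> \<le> \<epsilon> / (\<bar>c\<bar> + 1)"
      unfolding lmean_def by blast
    have "\<bar>lavg L (\<lambda>x. c * f x) x - c * mean f\<bar> \<le> \<epsilon>" if "x \<in> carrier G" for x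
    proof -
      have "\<bar>lavg L (\<lambda>x. c * f x) x - c * mean f\<bar> = \<bar>c\<bar> * \<bar>lavg L f x - mean f\<bar>"
        by (simp add: lavg_cmult flip: abs_mult right_diff_distrib)
      also have "\<dots> \<le> (\<bar>c\<bar> + 1) * (\<epsilon> / (\<bar>c\<bar> + 1))" using L(2)[OF that] by (intro mult_mono) auto
      finally show ?thesis by simp
    qed
    then show ?thesis using L(1) by blast
  qed
  then have "lmean (\<lambda>x. c * f x) (c * mean f)" by (simp add: lmean_def)
  then show ?thesis using lmean_iff[of "\<lambda>x. c * f x"] f by (simp add: continuous_map_real_mult_left)
qed

lemma mean_nonneg:
  assumes f: "cont f" and nonneg: "\<And>x. x \<in> carrier G \<Longrightarrow> 0 \<le> f x"
  shows "0 \<le> mean f"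
proof (rule field_le_epsilon)
  fix \<epsilon> :: real assume "\<epsilon> > 0"
  moreover have "lmean f (mean f)" by (simp add: lmean_iff f)
  ultimately obtain L where L: "L \<in> lists_in" "\<bar>lavg L f \<one> - mean f\<bar> \<le> \<epsilon>"
    unfolding lmean_def using one_closed by blast
  moreover have "0 \<le> lavg L f \<one>"
    unfolding lavg_def using L(1) nonneg
    by (intro divide_nonneg_nonneg sum_list_nonneg) (auto simp: lists_in_def subset_eq)
  ultimately show "0 \<le> mean f + \<epsilon>" by linarith
qed

lemma mean_mono:
  assumes f: "cont f" and g: "cont g" and le: "\<And>x. x \<in> carrier G \<Longrightarrow> f x \<le> g x"
  shows "mean f \<le> mean g"
proof -
  have "0 \<le> mean (\<lambda>x. g x + (-1) * f x)"
    using f g le by (intro mean_nonneg continuous_map_add continuous_map_real_mult_left) auto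
  also have "\<dots> = mean g - mean f"
    using mean_add[OF g continuous_map_real_mult_left[OF f, of "-1"]] mean_cmult[OF f, of "-1"] by simp
  finally show ?thesis by simp
qed

lemma mean_abs_diff_le:
  assumes f: "cont f" and g: "cont g" and le: "\<And>x. x \<in> carrier G \<Longrightarrow> \<bar>f x - g x\<bar> \<le> \<epsilon>"
  shows "\<bar>mean f - mean g\<bar> \<le> \<epsilon>"
proof -
  have "mean f \<le> mean (\<lambda>x. g x + \<epsilon>)"
    using f g le by (intro mean_mono continuous_map_add) (auto simp: abs_le_iff algebra_simps)
  moreover have "mean g \<le> mean (\<lambda>x. f x + \<epsilon>)"
    using f g le by (intro mean_mono continuous_map_add) (auto simp: abs_le_iff algebra_simps)
  moreover have "mean (\<lambda>x. h x + \<epsilon>) = mean h + \<epsilon>" if "cont h" for h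
    using mean_add[OF that, of "\<lambda>_. \<epsilon>"] by (simp add: mean_const)
  ultimately show ?thesis using f g by (simp add: abs_le_iff)
qed

lemma mean_sum:
  assumes "finite I" "\<And>i. i \<in> I \<Longrightarrow> cont (f i)"
  shows "mean (\<lambda>x. \<Sum>i\<in>I. f i x) = (\<Sum>i\<in>I. mean (f i))"
  using assms
proof (induction I rule: finite_induct)
  case (insert i I)
  then show ?case using mean_add[of "f i" "\<lambda>x. \<Sum>i\<in>I. f i x"] by (simp add: continuous_map_sum)
qed (simp add: mean_const)

text \<open>The weight \<open>1 / N\<close>, the reciprocal of the number of translates of \<open>U\<close> covering the group,
  plays the role of a lower bound for the Haar measure of \<open>U\<close>.\<close>

lemma mean_lower_bound:
  assumes U: "openin \<tau> U" "\<one> \<in> U"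
  obtains \<delta> where "\<delta> > 0" "\<And>f c. cont f \<Longrightarrow> (\<And>x. x \<in> carrier G \<Longrightarrow> 0 \<le> f x) \<Longrightarrow>
      (\<And>u. u \<in> U \<Longrightarrow> c \<le> f u) \<Longrightarrow> \<delta> * c \<le> mean f"
proof -
  obtain A where A: "A \<in> lists_in" "\<And>x. x \<in> carrier G \<Longrightarrow> \<exists>a\<in>set A. x \<otimes> inv a \<in> U"
    using finite_translate_cover[OF U] by blast
  define D where "D = map (\<lambda>a. inv a) A"
  have D: "D \<in> lists_in" using A(1) by (auto simp: D_def lists_in_def)
  define \<delta> where "\<delta> = 1 / real (length D)"
  have "\<delta> > 0" using D by (auto simp: \<delta>_def lists_in_def)
  moreover have "\<delta> * c \<le> mean f"
    if f: "cont f" "\<And>x. x \<in> carrier G \<Longrightarrow> 0 \<le> f x" "\<And>u. u \<in> U \<Longrightarrow> c \<le> f u" for f c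
  proof -
    have "\<delta> * c \<le> ravg D f x" if x: "x \<in> carrier G" for x
    proof -
      obtain d where d: "d \<in> set D" "x \<otimes> d \<in> U" using A(2)[OF x] by (auto simp: D_def)
      have "c \<le> f (x \<otimes> d)" using f(3) d by blast
      also have "\<dots> \<le> (\<Sum>a\<leftarrow>D. f (x \<otimes> a))"
        using d D x f(2) by (intro member_le_sum_list) (auto simp: lists_in_def)
      finally show ?thesis by (simp add: ravg_def \<delta>_def divide_right_mono)
    qed
    then have "mean (\<lambda>_. \<delta> * c) \<le> mean (ravg D f)"
      using D f(1) by (intro mean_mono cont_ravg) (auto dest: lists_inD)
    then show ?thesis using mean_const mean_ravg[OF f(1) D] by simp
  qed
  ultimately show ?thesis using that by blast
qed

end

section \<open>Averaging polynomials over a compact operator group\<close>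

text \<open>The Banach-Steinhaus theorem by Baire category: the closed sets \<open>A n\<close> cover
  the space, so one of them contains a ball, and differences from its centre bound every operator in
  \<open>F\<close>.\<close>

theorem uniform_boundedness:
  fixes F :: "('a::banach \<Rightarrow>\<^sub>L 'b::real_normed_vector) set"
  assumes "\<And>x. bounded ((\<lambda>f. blinfun_apply f x) ` F)"
  shows "bounded F"
proof -
  define A where "A n = (\<Inter>f\<in>F. {x. norm (blinfun_apply f x) \<le> real n})" for n
  have closed: "closed (A n)" for n
    unfolding A_def by (intro closed_INT ballI closed_Collect_le continuous_intros)
  have cover: "\<Union>(range A) = UNIV"
  proof -
    have "\<exists>n. x \<in> A n" for x
    proof -
      obtain b where "\<And>f. f \<in> F \<Longrightarrow> norm (blinfun_apply f x) \<le> b"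
        using assms[of x] unfolding bounded_iff by auto
      moreover obtain n where "b \<le> real n" using real_arch_simple by blast
      ultimately have "x \<in> A n" unfolding A_def using order_trans by fastforce
      then show ?thesis ..
    qed
    then show ?thesis by blast
  qed
  obtain n where n: "interior (A n) \<noteq> {}"
  proof (rule ccontr)
    assume "\<not> thesis"
    then have "interior (A n) = {}" for n using that by blast
    then have "euclidean interior_of \<Union>(range A) = {}"
      using closed by (intro Baire_category_alt) (auto simp: completely_metrizable_space_euclidean)
    then show False by (simp add: cover)
  qed
  then obtain y e where e: "e > 0" "cball y e \<subseteq> A n"
    by (metis all_not_in_conv mem_interior_cball)
  have "norm f \<le> 2 * real n / e" if f: "f \<in> F" for f
  proof (rule norm_blinfun_bound)
    show "0 \<le> 2 * real n / e" using e by simp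
    fix x
    show "norm (blinfun_apply f x) \<le> 2 * real n / e * norm x"
    proof (cases "x = 0")
      case False
      \<comment> \<open>\<open>c *\<^sub>R x\<close> has norm \<open>e\<close>, so
        \<open>y + c *\<^sub>R x\<close> stays in the closed ball.\<close>
      define c where "c = e / norm x"
      have "c > 0" using False e by (simp add: c_def)
      have "y \<in> cball y e" "y + c *\<^sub>R x \<in> cball y e"
        using e False by (auto simp: c_def dist_norm)
      then have "norm (blinfun_apply f y) \<le> real n" "norm (blinfun_apply f (y + c *\<^sub>R x)) \<le> real n"
        using subsetD[OF e(2)] f unfolding A_def by blast+
      then have "norm (blinfun_apply f (y + c *\<^sub>R x) - blinfun_apply f y) \<le> 2 * real n"
        using norm_triangle_ineq4[of "blinfun_apply f (y + c *\<^sub>R x)" "blinfun_apply f y"] by linarith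
      then have "c * norm (blinfun_apply f x) \<le> 2 * real n"
        using \<open>c > 0\<close> by (simp add: blinfun.add_right blinfun.scaleR_right)
      then show ?thesis using e False by (simp add: c_def field_simps)
    qed simp
  qed
  then show ?thesis unfolding bounded_iff by blast
qed

section \<open>Averages along the orbits of a linear action\<close>

locale compact_linear_action =
  fixes G :: "('a::banach \<Rightarrow>\<^sub>L 'a) set" and \<tau> :: "('a \<Rightarrow>\<^sub>L 'a) topology"
  assumes compact_group: "compact_operator_group G \<tau>"
    and separately_continuous: "acts_separately_continuously G \<tau>"
begin

sublocale compact_topological_group "operator_monoid G" \<tau>
  using compact_group
  unfolding compact_operator_group_def topological_operator_group_def
    compact_topological_group_def compact_topological_group_axioms_def
  by (simp add: operator_monoid_def)

lemma operator_monoid_simps [simp]: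
  "carrier (operator_monoid G) = G" "\<gamma> \<otimes>\<^bsub>operator_monoid G\<^esub> \<delta> = \<gamma> o\<^sub>L \<delta>"
  "\<one>\<^bsub>operator_monoid G\<^esub> = id_blinfun"
  by (simp_all add: operator_monoid_def)

definition average :: "('a \<Rightarrow> real) \<Rightarrow> 'a \<Rightarrow> real"
  where "average R x = mean (\<lambda>\<gamma>. R (blinfun_apply \<gamma> x))"

lemma continuous_map_orbit: "continuous_map \<tau> euclidean (\<lambda>\<gamma>. blinfun_apply \<gamma> x)"
  using separately_continuous by (simp add: acts_separately_continuously_def)

lemma cont_orbit:
  assumes "continuous_on UNIV R"
  shows "cont (\<lambda>\<gamma>. R (blinfun_apply \<gamma> x))"
  using continuous_map_compose[OF continuous_map_orbit, of euclideanreal R x] assms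
  by (simp add: o_def)

lemma compact_orbit: "compact ((\<lambda>\<gamma>. blinfun_apply \<gamma> x) ` G)"
  using image_compactin[OF _ continuous_map_orbit, of G x] compact topspace_carrier
  by (simp add: compact_space_def)

text \<open>Compactness in \<open>\<tau>\<close> gives bounds on each orbit only; completeness of
  the space turns them into a bound on operator norms.\<close>

lemma bounded_operators: "bounded G"
  by (intro uniform_boundedness compact_imp_bounded compact_orbit)

text \<open>Moving \<open>x\<close> by \<open>\<delta>\<close> translates the averaged function on
  the group from the right.\<close>

lemma invariant_average:
  assumes "continuous_on UNIV R"
  shows "invariant_function G (average R)"
  unfolding invariant_function_def
proof (intro ballI allI)
  fix \<delta> x assume "\<delta> \<in> G"
  then show "average R (blinfun_apply \<delta> x) = average R x"
    using mean_translate[OF cont_orbit[OF assms], of \<delta> x] by (simp add: average_def)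
qed

lemma continuous_average:
  assumes R: "continuous_on UNIV R"
  shows "continuous_on UNIV (average R)"
proof -
  obtain C where C: "C > 0" "\<And>\<gamma>. \<gamma> \<in> G \<Longrightarrow> norm \<gamma> \<le> C"
    using bounded_operators bounded_pos by metis
  have "\<exists>d>0. \<forall>y. dist y x < d \<longrightarrow> dist (average R y) (average R x) < e" if "e > 0" for x e
  proof -
    define Orb where "Orb = (\<lambda>\<gamma>. blinfun_apply \<gamma> x) ` G"
    \<comment> \<open>Compactness of the orbit yields one neighbourhood \<open>X\<close> of 0 that
      works at all of its points. The norm bound \<open>C\<close> then places every
      \<open>blinfun_apply \<gamma> (y - x)\<close> in \<open>X\<close> at once.\<close>
    have "continuous_on (UNIV \<times> Orb) (\<lambda>(h, u). R (u + h))"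
      unfolding case_prod_beta by (intro continuous_on_compose2[OF R] continuous_intros) auto
    then obtain X where X: "0 \<in> X" "open X"
      "\<forall>h\<in>X \<inter> UNIV. \<forall>u\<in>Orb. dist (R (u + h)) (R (u + 0)) \<le> e / 2"
      using continuous_on_prod_compactE[of UNIV Orb "\<lambda>(h, u). R (u + h)" 0 "e / 2"]
        compact_orbit \<open>e > 0\<close> unfolding Orb_def by auto
    obtain d where d: "d > 0" "ball 0 d \<subseteq> X" using X open_contains_ball by blast
    have "dist (average R y) (average R x) < e" if y: "dist y x < d / C" for y
    proof -
      have "\<bar>R (blinfun_apply \<gamma> y) - R (blinfun_apply \<gamma> x)\<bar> \<le> e / 2" if \<gamma>: "\<gamma> \<in> G" for \<gamma>
      proof -
        have "norm (blinfun_apply \<gamma> (y - x)) \<le> C * norm (y - x)"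
          using norm_blinfun[of \<gamma> "y - x"] mult_right_mono[OF C(2)[OF \<gamma>], of "norm (y - x)"] by simp
        also have "\<dots> < d" using y C(1) by (simp add: dist_norm field_simps)
        finally have "blinfun_apply \<gamma> (y - x) \<in> X" using d(2) by auto
        then have "dist (R (blinfun_apply \<gamma> x + blinfun_apply \<gamma> (y - x))) (R (blinfun_apply \<gamma> x + 0)) \<le> e / 2"
          using X(3) \<gamma> by (auto simp: Orb_def)
        then show ?thesis by (simp add: dist_real_def blinfun.diff_right)
      qed
      then have "\<bar>average R y - average R x\<bar> \<le> e / 2"
        unfolding average_def by (intro mean_abs_diff_le cont_orbit R) simp
      then show ?thesis using \<open>e > 0\<close> by (simp add: dist_real_def)
    qed
    then show ?thesis using d(1) C(1) by (intro exI[of _ "d / C"]) simp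
  qed
  then show ?thesis unfolding continuous_on_iff by blast
qed

lemma homogeneous_average:
  assumes hom: "homogeneous_polynomial n R" and R: "continuous_on UNIV R"
  shows "homogeneous_polynomial n (average R)"
proof -
  define B where "B = polarization n R"
  note B = multilinear_form_polarization[OF hom, folded B_def]
  define D where "D v = mean (\<lambda>\<gamma>. B (\<lambda>i. blinfun_apply \<gamma> (v i)))" for v
  \<comment> \<open>The polarization is a finite combination of values of \<open>R\<close> at images
    under \<open>\<gamma>\<close> of sums of the \<open>v i\<close>, hence continuous in
    \<open>\<gamma>\<close>. This is why it replaces an arbitrary form representing
    \<open>R\<close>.\<close>
  have B_cont: "cont (\<lambda>\<gamma>. B (\<lambda>i. blinfun_apply \<gamma> (v i)))" for v
    unfolding B_def polarization_def divide_inverse blinfun.sum_right[symmetric]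
    by (intro continuous_map_real_mult_right continuous_map_sum continuous_map_real_mult_left
        cont_orbit R) auto
  have "multilinear_form n D"
    unfolding multilinear_form_def
  proof (intro conjI allI impI)
    fix v w :: "nat \<Rightarrow> 'a" assume "\<forall>i<n. v i = w i"
    then have "B (\<lambda>i. blinfun_apply \<gamma> (v i)) = B (\<lambda>i. blinfun_apply \<gamma> (w i))" for \<gamma>
      by (intro multilinear_formD(1)[OF B]) simp
    then show "D v = D w" by (simp add: D_def)
  next
    fix i v assume i: "i < n"
    define E where "E x \<gamma> = B (\<lambda>j. blinfun_apply \<gamma> ((v(i := x)) j))"
      for x and \<gamma> :: "'a \<Rightarrow>\<^sub>L 'a"
    have E: "E x \<gamma> = B ((\<lambda>j. blinfun_apply \<gamma> (v j))(i := blinfun_apply \<gamma> x))" for x \<gamma>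
      unfolding E_def by (rule arg_cong[where f = B]) auto
    note lin = multilinear_formD(2)[OF B i]
    have E_cont: "cont (E x)" for x unfolding E_def[abs_def] by (rule B_cont)
    have "E (x + y) = (\<lambda>\<gamma>. E x \<gamma> + E y \<gamma>)" for x y
      unfolding E blinfun.add_right by (rule ext) (rule linear_add[OF lin])
    moreover have "E (c *\<^sub>R x) = (\<lambda>\<gamma>. c * E x \<gamma>)" for c x
      unfolding E blinfun.scaleR_right by (rule ext) (simp add: linear_scale[OF lin])
    ultimately have "linear (\<lambda>x. mean (E x))"
      by (intro linearI) (simp_all add: mean_add mean_cmult E_cont)
    then show "linear (\<lambda>x. D (v(i := x)))" by (simp only: D_def E_def[abs_def])
  qed
  moreover have "average R x = D (\<lambda>_. x)" for x
    by (simp add: average_def D_def B_def polarization_diagonal[OF hom])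
  ultimately show ?thesis unfolding homogeneous_polynomial_def by blast
qed

text \<open>The components of \<open>R\<close> are continuous by
  \<open>continuous_homogeneous_components\<close>, so \<open>mean_sum\<close> can average them
  separately.\<close>

lemma polynomial_average:
  assumes poly: "polynomial_on_space R" and R: "continuous_on UNIV R"
  shows "polynomial_on_space (average R)"
proof -
  obtain m p where p: "\<And>k. k \<le> m \<Longrightarrow> homogeneous_polynomial k (p k)" "\<And>x. R x = (\<Sum>k\<le>m. p k x)"
    using poly unfolding polynomial_on_space_def by blast
  have p_cont: "continuous_on UNIV (p k)" if "k \<le> m" for k
    using continuous_homogeneous_components[of m p k] p R that by simp
  have "average R x = (\<Sum>k\<le>m. average (p k) x)" for x
    unfolding average_def p(2) using p_cont by (intro mean_sum cont_orbit) auto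
  then show ?thesis
    unfolding polynomial_on_space_def using homogeneous_average[OF p(1) p_cont]
    by (intro exI[of _ m] exI[of _ "\<lambda>k. average (p k)"]) simp
qed

text \<open>An even power is nonnegative, so averaging causes no cancellation and the absolute
  values in \<open>separates\<close> disappear.\<close>

lemma average_even_power_separates:
  assumes K: "invariant_set G K" "K \<noteq> {}" and Q: "continuous_on UNIV Q" and sep: "separates Q z K"
  obtains k where "separates (average (\<lambda>x. Q x ^ (2 * k))) z K"
proof -
  obtain s where s: "(SUP w\<in>K. ereal \<bar>Q w\<bar>) < ereal s" "s < \<bar>Q z\<bar>"
    using ereal_dense2[OF sep[unfolded separates_def]] by auto
  have Ks: "\<bar>Q w\<bar> \<le> s" if "w \<in> K" for w
  proof -
    have "ereal \<bar>Q w\<bar> < ereal s" using s(1) SUP_upper[OF that, of "\<lambda>w. ereal \<bar>Q w\<bar>"] by (rule le_less_trans[rotated])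
    then show ?thesis by simp
  qed
  \<comment> \<open>A point of \<open>K\<close> forces \<open>s\<close> to be nonnegative, as the
    comparison of powers requires.\<close>
  obtain w where "w \<in> K" using K(2) by blast
  then have "s \<ge> 0" using Ks[of w] by linarith
  \<comment> \<open>Being below the value at \<open>z\<close>, \<open>t\<close> makes
    \<open>U\<close> an open neighbourhood of the identity; being above \<open>s\<close>, it makes
    the ratio \<open>s / t\<close> less than 1.\<close>
  define t where "t = (s + \<bar>Q z\<bar>) / 2"
  have t: "s < t" "t < \<bar>Q z\<bar>" "t > 0" using s(2) \<open>s \<ge> 0\<close> by (auto simp: t_def)
  define U where "U = {\<gamma> \<in> topspace \<tau>. \<bar>Q (blinfun_apply \<gamma> z)\<bar> \<in> {t<..}}"
  have "openin \<tau> U" unfolding U_def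
    by (intro openin_continuous_map_preimage[OF continuous_map_real_abs] cont_orbit Q) simp
  moreover have "id_blinfun \<in> U"
    using t one_closed topspace_carrier by (simp add: U_def)
  ultimately obtain \<delta> where \<delta>: "\<delta> > 0"
    "\<And>f c. cont f \<Longrightarrow> (\<And>\<gamma>. \<gamma> \<in> G \<Longrightarrow> 0 \<le> f \<gamma>) \<Longrightarrow> (\<And>u. u \<in> U \<Longrightarrow> c \<le> f u) \<Longrightarrow> \<delta> * c \<le> mean f"
    using mean_lower_bound[of U] by auto
  \<comment> \<open>\<open>\<delta>\<close> depends on \<open>U\<close> alone, so the exponent can
    be chosen after it, with \<open>s ^ (2 * k) < \<delta> * t ^ (2 * k)\<close>.\<close>
  have "s\<^sup>2 / t\<^sup>2 < 1" using t \<open>s \<ge> 0\<close> by (simp add: power_strict_mono)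
  then obtain k where k: "(s\<^sup>2 / t\<^sup>2) ^ k < \<delta>" using real_arch_pow_inv[OF \<delta>(1)] by blast
  define R where "R x = Q x ^ (2 * k)" for x
  have R: "continuous_on UNIV R" unfolding R_def by (intro continuous_intros Q)
  have R_abs: "R x = \<bar>Q x\<bar> ^ (2 * k)" for x by (simp add: R_def power_even_abs)
  have R_nonneg: "R x \<ge> 0" for x by (simp add: R_abs)
  have average_nonneg: "average R x \<ge> 0" for x
    unfolding average_def by (intro mean_nonneg cont_orbit R R_nonneg)
  have "average R w \<le> s ^ (2 * k)" if w: "w \<in> K" for w
  proof -
    have "R (blinfun_apply \<gamma> w) \<le> s ^ (2 * k)" if "\<gamma> \<in> G" for \<gamma>
      using that w K(1) Ks unfolding R_abs by (intro power_mono) (auto simp: invariant_set_def)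
    then have "average R w \<le> mean (\<lambda>_. s ^ (2 * k))"
      unfolding average_def by (intro mean_mono cont_orbit R) auto
    then show ?thesis by (simp only: mean_const)
  qed
  then have "(SUP w\<in>K. ereal \<bar>average R w\<bar>) \<le> ereal (s ^ (2 * k))"
    using average_nonneg by (intro SUP_least) simp
  also have "s ^ (2 * k) < \<delta> * t ^ (2 * k)"
    using k t by (simp add: power_mult power_divide divide_less_eq)
  also have "\<delta> * t ^ (2 * k) \<le> average R z"
    unfolding average_def
  proof (rule \<delta>(2))
    fix \<gamma> assume "\<gamma> \<in> U"
    then show "t ^ (2 * k) \<le> R (blinfun_apply \<gamma> z)"
      unfolding R_abs using t by (intro power_mono) (auto simp: U_def)
  qed (intro cont_orbit R R_nonneg)+
  finally have "separates (average R) z K"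
    using average_nonneg by (simp add: separates_def)
  then show ?thesis using that unfolding R_def[abs_def] by blast
qed

end

theorem theorem2p1:
  fixes G :: "('a::banach \<Rightarrow>\<^sub>L 'a) set"
    and \<tau> :: "('a \<Rightarrow>\<^sub>L 'a) topology"
    and K :: "'a set"
    and z :: 'a
    and Q :: "'a \<Rightarrow> real"
  assumes "compact_operator_group G \<tau>"
    and "acts_separately_continuously G \<tau>"
    and "invariant_set G K"
    and "z \<notin> K"
    and "continuous_polynomial Q"
    and "separates Q z K"
  shows "(\<exists>P. continuous_polynomial P \<and> invariant_function G P \<and> separates P z K) \<and>
    (is_homogeneous Q \<longrightarrow>
      (\<exists>P. continuous_polynomial P \<and> is_homogeneous P \<and> invariant_function G P \<and>
        separates P z K))"
proof (cases "K = {}")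
  case True
  \<comment> \<open>The supremum over the empty set is minus infinity in \<open>ereal\<close>, so a
    constant, homogeneous of degree 0, already separates.\<close>
  define P :: "'a \<Rightarrow> real" where "P = (\<lambda>_. 1)"
  have hom: "homogeneous_polynomial 0 P" unfolding P_def by (rule homogeneous_polynomial_const)
  then have "continuous_polynomial P"
    using polynomial_on_space_homogeneous by (auto simp: continuous_polynomial_def P_def)
  moreover have "invariant_function G P" by (simp add: invariant_function_def P_def)
  moreover have "separates P z K" by (simp add: separates_def True bot_ereal_def)
  ultimately show ?thesis using hom is_homogeneous_def by blast
next
  case False
  interpret compact_linear_action G \<tau> using assms(1,2) by unfold_locales
  have Q: "polynomial_on_space Q" "continuous_on UNIV Q"
    using assms(5) by (simp_all add: continuous_polynomial_def)
  obtain k where sep: "separates (average (\<lambda>x. Q x ^ (2 * k))) z K"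
    using average_even_power_separates[OF assms(3) False Q(2) assms(6)] .
  define R where "R = (\<lambda>x. Q x ^ (2 * k))"
  have R: "polynomial_on_space R" "continuous_on UNIV R"
    using polynomial_on_space_power[OF Q(1)] Q(2) by (auto simp: R_def intro: continuous_on_power)
  have "continuous_polynomial (average R)"
    using R polynomial_average continuous_average by (simp add: continuous_polynomial_def)
  \<comment> \<open>The same average serves both claims: if \<open>Q\<close> has degree
    \<open>n\<close>, then \<open>R\<close> and its average have degree
    \<open>2 * k * n\<close>.\<close>
  moreover have "is_homogeneous (average R)" if "is_homogeneous Q"
    using that homogeneous_polynomial_power[of _ Q "2 * k"] homogeneous_average[OF _ R(2)]
    unfolding is_homogeneous_def R_def by blast
  ultimately show ?thesis using invariant_average[OF R(2)] sep[folded R_def] by blast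
qed

end
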